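(* For every sequent $\Gamma\Rightarrow\beta$: $\vdash_{\mathsf{Gb}}\Gamma\Rightarrow\beta$ if and only if $\Gamma\Rightarrow\beta$ is derivable in $\mathsf{Gb}$ without any application of the rule $(\mathrm{Cut})$.
   Context: Formulas of $\mathsf{Gb}$: variables $p$, the constant $\bot$, and $\alpha\cdot\beta$, $\alpha\backslash\beta$, $\alpha\wedge\beta$, $\alpha\vee\beta$, $\alpha\ast\beta$, $\alpha\rightarrow\beta$. Formula structures: every formula is a structure, and if $\Gamma,\Delta$ are structures so are $(\Gamma,\Delta)$ and $(\Gamma;\Delta)$. A context $\Gamma[-]$ is a structure with one designated hole; $\Gamma[\Delta]$ is the result of filling it with $\Delta$. A sequent is $\Gamma\Rightarrow\alpha$ with $\Gamma$ a structure and $\alpha$ a formula. Rules of $\mathsf{Gb}$ (premises / conclusion): $(\mathrm{Id})$ $\alpha\Rightarrow\alpha$; $(\cdot\mathrm{L})$ $\Gamma[\alpha,\beta]\Rightarrow\gamma$ / $\Gamma[\alpha\cdot\beta]\Rightarrow\gamma$; $(\cdot\mathrm{R})$ $\Gamma_1\Rightarrow\alpha$, $\Gamma_2\Rightarrow\beta$ / $\Gamma_1,\Gamma_2\Rightarrow\alpha\cdot\beta$; $(\ast\mathrm{L})$ $\Gamma[\alpha;\beta]\Rightarrow\gamma$ / $\Gamma[\alpha\ast\beta]\Rightarrow\gamma$; $(\ast\mathrm{R})$ $\Gamma_1\Rightarrow\alpha$, $\Gamma_2\Rightarrow\beta$ / $\Gamma_1;\Gamma_2\Rightarrow\alpha\ast\beta$;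 $(\backslash\mathrm{L})$ $\Delta\Rightarrow\alpha$, $\Gamma[\beta]\Rightarrow\gamma$ / $\Gamma[\Delta,\alpha\backslash\beta]\Rightarrow\gamma$; $(\backslash\mathrm{R})$ $\alpha,\Gamma\Rightarrow\beta$ / $\Gamma\Rightarrow\alpha\backslash\beta$; $(\rightarrow\mathrm{L})$ $\Delta\Rightarrow\alpha$, $\Gamma[\beta]\Rightarrow\gamma$ / $\Gamma[\Delta;\alpha\rightarrow\beta]\Rightarrow\gamma$; $(\rightarrow\mathrm{R})$ $\alpha;\Gamma\Rightarrow\beta$ / $\Gamma\Rightarrow\alpha\rightarrow\beta$; $(\wedge\mathrm{L})$ $\Gamma[\alpha]\Rightarrow\beta$ / $\Gamma[\alpha\wedge\gamma]\Rightarrow\beta$ and $\Gamma[\alpha]\Rightarrow\beta$ / $\Gamma[\gamma\wedge\alpha]\Rightarrow\beta$; $(\wedge\mathrm{R})$ $\Gamma\Rightarrow\alpha$, $\Gamma\Rightarrow\beta$ / $\Gamma\Rightarrow\alpha\wedge\beta$; $(\vee\mathrm{L})$ $\Gamma[\alpha]\Rightarrow\gamma$, $\Gamma[\beta]\Rightarrow\gamma$ / $\Gamma[\alpha\vee\beta]\Rightarrow\gamma$; $(\vee\mathrm{R})$ $\Gamma\Rightarrow\alpha$ / $\Gamma\Rightarrow\alpha\vee\beta$ and $\Gamma\Rightarrow\alpha$ / $\Gamma\Rightarrow\beta\vee\alpha$; $(\bot)$ $\Delta\Rightarrow\bot$ / $\Gamma[\Delta]\Rightarrow\alpha$; $(\mathrm{Cut})$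 $\Delta\Rightarrow\alpha$, $\Gamma[\alpha]\Rightarrow\beta$ / $\Gamma[\Delta]\Rightarrow\beta$; $(\mathrm{R}\text{-}\bot)$ $(\Delta_1,\Delta_2);\Delta_3\Rightarrow\bot$ / $(\Delta_1,\Delta_3);\Delta_2\Rightarrow\bot$; $(\mathrm{Ex})$ $\Gamma[\Delta_1,\Delta_2]\Rightarrow\beta$ / $\Gamma[\Delta_2,\Delta_1]\Rightarrow\beta$; $(\mathrm{Ex}^;)$ $\Gamma[\Delta_1;\Delta_2]\Rightarrow\beta$ / $\Gamma[\Delta_2;\Delta_1]\Rightarrow\beta$; $(\mathrm{As}_1)$ $\Gamma[\Delta_1,(\Delta_2,\Delta_3)]\Rightarrow\beta$ / $\Gamma[(\Delta_1,\Delta_2),\Delta_3]\Rightarrow\beta$; $(\mathrm{As}_2)$ the converse of $(\mathrm{As}_1)$. *)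

theory Defs
  imports Main
begin

datatype 'v fm =
    Var 'v
  | Bot
  | Dot "'v fm" "'v fm"      (* \<alpha> \<cdot> \<beta> *)
  | Under "'v fm" "'v fm"    (* \<alpha> \ \<beta>, the residual of \<cdot> *)
  | Conj "'v fm" "'v fm"
  | Disj "'v fm" "'v fm"
  | Star "'v fm" "'v fm"     (* \<alpha> * \<beta> *)
  | Arrow "'v fm" "'v fm"    (* \<alpha> \<rightarrow> \<beta>, the residual of * *)

text \<open>Structures are nonempty binary trees; no associativity or commutativity is built in.\<close>

datatype 'v struct =
    Fm "'v fm"
  | Comma "'v struct" "'v struct"
  | Semi "'v struct" "'v struct"

datatype 'v ctx =
    Hole
  | CommaL "'v ctx" "'v struct"
  | CommaR "'v struct" "'v ctx"
  | SemiL "'v ctx" "'v struct"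
  | SemiR "'v struct" "'v ctx"

primrec fill :: "'v ctx \<Rightarrow> 'v struct \<Rightarrow> 'v struct" where
  "fill Hole D = D"
| "fill (CommaL G S) D = Comma (fill G D) S"
| "fill (CommaR S G) D = Comma S (fill G D)"
| "fill (SemiL G S) D = Semi (fill G D) S"
| "fill (SemiR S G) D = Semi S (fill G D)"

datatype 'v sequent = Seq "'v struct" "'v fm"  (infix "\<rightarrowtail>" 50)

datatype rule_name =
    Id | DotL | DotR | StarL | StarR | UnderL | UnderR | ArrowL | ArrowR
  | ConjL | ConjR | DisjL | DisjR | BotRule | Cut | RBot | Ex | ExSemi | As1 | As2

text \<open>\<open>Gb_rule r ps c\<close>: the sequent \<open>c\<close> follows from the list of premises \<open>ps\<close>
  by one application of rule \<open>r\<close>.\<close>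

inductive Gb_rule :: "rule_name \<Rightarrow> 'v sequent list \<Rightarrow> 'v sequent \<Rightarrow> bool" where
  Id: "Gb_rule Id [] (Fm a \<rightarrowtail> a)"
| DotL: "Gb_rule DotL [fill G (Comma (Fm a) (Fm b)) \<rightarrowtail> c] (fill G (Fm (Dot a b)) \<rightarrowtail> c)"
| DotR: "Gb_rule DotR [G1 \<rightarrowtail> a, G2 \<rightarrowtail> b] (Comma G1 G2 \<rightarrowtail> Dot a b)"
| StarL: "Gb_rule StarL [fill G (Semi (Fm a) (Fm b)) \<rightarrowtail> c] (fill G (Fm (Star a b)) \<rightarrowtail> c)"
| StarR: "Gb_rule StarR [G1 \<rightarrowtail> a, G2 \<rightarrowtail> b] (Semi G1 G2 \<rightarrowtail> Star a b)"
| UnderL: "Gb_rule UnderL [D \<rightarrowtail> a, fill G (Fm b) \<rightarrowtail> c] (fill G (Comma D (Fm (Under a b))) \<rightarrowtail> c)"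
| UnderR: "Gb_rule UnderR [Comma (Fm a) S \<rightarrowtail> b] (S \<rightarrowtail> Under a b)"
| ArrowL: "Gb_rule ArrowL [D \<rightarrowtail> a, fill G (Fm b) \<rightarrowtail> c] (fill G (Semi D (Fm (Arrow a b))) \<rightarrowtail> c)"
| ArrowR: "Gb_rule ArrowR [Semi (Fm a) S \<rightarrowtail> b] (S \<rightarrowtail> Arrow a b)"
| ConjL1: "Gb_rule ConjL [fill G (Fm a) \<rightarrowtail> b] (fill G (Fm (Conj a c)) \<rightarrowtail> b)"
| ConjL2: "Gb_rule ConjL [fill G (Fm a) \<rightarrowtail> b] (fill G (Fm (Conj c a)) \<rightarrowtail> b)"
| ConjR: "Gb_rule ConjR [S \<rightarrowtail> a, S \<rightarrowtail> b] (S \<rightarrowtail> Conj a b)"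
| DisjL: "Gb_rule DisjL [fill G (Fm a) \<rightarrowtail> c, fill G (Fm b) \<rightarrowtail> c] (fill G (Fm (Disj a b)) \<rightarrowtail> c)"
| DisjR1: "Gb_rule DisjR [S \<rightarrowtail> a] (S \<rightarrowtail> Disj a b)"
| DisjR2: "Gb_rule DisjR [S \<rightarrowtail> a] (S \<rightarrowtail> Disj b a)"
| BotRule: "Gb_rule BotRule [D \<rightarrowtail> Bot] (fill G D \<rightarrowtail> a)"
| Cut: "Gb_rule Cut [D \<rightarrowtail> a, fill G (Fm a) \<rightarrowtail> b] (fill G D \<rightarrowtail> b)"
| RBot: "Gb_rule RBot [Semi (Comma D1 D2) D3 \<rightarrowtail> Bot] (Semi (Comma D1 D3) D2 \<rightarrowtail> Bot)"
| Ex: "Gb_rule Ex [fill G (Comma D1 D2) \<rightarrowtail> b] (fill G (Comma D2 D1) \<rightarrowtail> b)"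
| ExSemi: "Gb_rule ExSemi [fill G (Semi D1 D2) \<rightarrowtail> b] (fill G (Semi D2 D1) \<rightarrowtail> b)"
| As1: "Gb_rule As1 [fill G (Comma D1 (Comma D2 D3)) \<rightarrowtail> b] (fill G (Comma (Comma D1 D2) D3) \<rightarrowtail> b)"
| As2: "Gb_rule As2 [fill G (Comma (Comma D1 D2) D3) \<rightarrowtail> b] (fill G (Comma D1 (Comma D2 D3)) \<rightarrowtail> b)"

text \<open>\<open>derivable R s\<close>: \<open>s\<close> is the root of a derivation that applies only rules named in \<open>R\<close>.\<close>

inductive derivable :: "rule_name set \<Rightarrow> 'v sequent \<Rightarrow> bool" for R where
  step: "r \<in> R \<Longrightarrow> Gb_rule r ps s \<Longrightarrow> \<forall>p \<in> set ps. derivable R p \<Longrightarrow> derivable R s"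

definition Gb_derivable :: "'v sequent \<Rightarrow> bool" where
  "Gb_derivable s \<longleftrightarrow> derivable UNIV s"

definition Gb_derivable_without_cut :: "'v sequent \<Rightarrow> bool" where
  "Gb_derivable_without_cut s \<longleftrightarrow> derivable (UNIV - {Cut}) s"

end

theory Submission
  imports Defs
begin

text \<open>
  Cut elimination is proved semantically, by Okada's method. Write \<open>\<turnstile>\<close> for cut-free derivability.
  The sets of structures that are intersections of sets \<open>{\<Delta>. \<turnstile> C[\<Delta>] \<Rightarrow> c}\<close> form a residuated
  lattice with two products; its least element is \<open>{\<Delta>. \<turnstile> \<Delta> \<Rightarrow> \<bottom>}\<close>, so that it validates the rule
  \<open>(R-\<bottom>)\<close>. Interpreting a variable \<open>p\<close> as \<open>{\<Delta>. \<turnstile> \<Delta> \<Rightarrow> p}\<close>, one shows by induction on \<open>a\<close>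
  that \<open>a \<in> \<lbrakk>a\<rbrakk> \<subseteq> {\<Delta>. \<turnstile> \<Delta> \<Rightarrow> a}\<close>. Every rule including \<open>(Cut)\<close> is sound for this
  interpretation, hence a derivable \<open>\<Gamma> \<Rightarrow> b\<close> gives \<open>\<Gamma> \<in> \<lbrakk>\<Gamma>\<rbrakk> \<subseteq> \<lbrakk>b\<rbrakk>\<close> and thus \<open>\<turnstile> \<Gamma> \<Rightarrow> b\<close>.
\<close>

section \<open>Closure operator on sets of structures\<close>

abbreviation cf :: "'v sequent \<Rightarrow> bool" where
  "cf \<equiv> derivable (UNIV - {Cut})"

lemma cf_rule:
  assumes "Gb_rule r ps s" "r \<noteq> Cut" "\<forall>p \<in> set ps. cf p"
  shows "cf s"
  using assms by (intro derivable.step[of r]) auto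

primrec ctx_comp :: "'v ctx \<Rightarrow> 'v ctx \<Rightarrow> 'v ctx" where
  "ctx_comp Hole D = D"
| "ctx_comp (CommaL C S) D = CommaL (ctx_comp C D) S"
| "ctx_comp (CommaR S C) D = CommaR S (ctx_comp C D)"
| "ctx_comp (SemiL C S) D = SemiL (ctx_comp C D) S"
| "ctx_comp (SemiR S C) D = SemiR S (ctx_comp C D)"

lemma fill_ctx_comp: "fill (ctx_comp C D) x = fill C (fill D x)"
  by (induction C) auto

text \<open>Regard each pair \<open>C\<close>, \<open>c\<close> as a test on structures.
  \<open>cl\<close> is the closure operator of the resulting polarity: \<open>x\<close> must pass
  every test that all of \<open>X\<close> passes.\<close>

definition cl :: "'v struct set \<Rightarrow> 'v struct set" where
  "cl X = {x. \<forall>C c. (\<forall>y\<in>X. cf (fill C y \<rightarrowtail> c)) \<longrightarrow> cf (fill C x \<rightarrowtail> c)}"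

definition closed_set :: "'v struct set \<Rightarrow> bool" where
  "closed_set X \<longleftrightarrow> cl X \<subseteq> X"

lemma clI: "(\<And>C c. \<forall>y\<in>X. cf (fill C y \<rightarrowtail> c) \<Longrightarrow> cf (fill C x \<rightarrowtail> c)) \<Longrightarrow> x \<in> cl X"
  by (auto simp: cl_def)

lemma clD: "x \<in> cl X \<Longrightarrow> (\<And>y. y \<in> X \<Longrightarrow> cf (fill C y \<rightarrowtail> c)) \<Longrightarrow> cf (fill C x \<rightarrowtail> c)"
  by (auto simp: cl_def)

lemma subset_cl: "x \<in> X \<Longrightarrow> x \<in> cl X"
  by (auto simp: cl_def)

text \<open>A test on \<open>fill C x\<close> is a test on \<open>x\<close> in the composed context,
  so membership in a closed set need only be checked on generators.\<close>

lemma fill_cl_closed: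
  assumes "closed_set Y" "x \<in> cl X" "\<And>y. y \<in> X \<Longrightarrow> fill C y \<in> Y"
  shows "fill C x \<in> Y"
proof -
  have "fill C x \<in> cl Y"
  proof (rule clI)
    fix D c assume "\<forall>y\<in>Y. cf (fill D y \<rightarrowtail> c)"
    with assms(3) have "cf (fill (ctx_comp D C) y \<rightarrowtail> c)" if "y \<in> X" for y
      using that by (simp add: fill_ctx_comp)
    from clD[OF assms(2) this] show "cf (fill D (fill C x) \<rightarrowtail> c)"
      by (simp add: fill_ctx_comp)
  qed
  with assms(1) show ?thesis by (auto simp: closed_set_def)
qed

lemma closed_cl: "closed_set (cl X)"
  unfolding closed_set_def by (auto simp: cl_def)

lemma closed_Int: "closed_set X \<Longrightarrow> closed_set Y \<Longrightarrow> closed_set (X \<inter> Y)"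
  unfolding closed_set_def cl_def by blast

lemma closed_succedent: "closed_set {x. cf (x \<rightarrowtail> c)}"
  unfolding closed_set_def
proof
  fix x assume "x \<in> cl {x. cf (x \<rightarrowtail> c)}"
  from clD[OF this, of Hole c] show "x \<in> {x. cf (x \<rightarrowtail> c)}" by simp
qed

lemma closed_fill_preimage:
  assumes "closed_set Y"
  shows "closed_set {z. \<forall>C\<in>K. fill C z \<in> Y}"
  unfolding closed_set_def using fill_cl_closed[OF assms] by blast

text \<open>The empty set passes all tests, and \<open>BotRule\<close> derives every test from the
  single one given by \<open>Hole\<close> and \<open>Bot\<close>.\<close>

lemma cl_empty: "cl {} = {x. cf (x \<rightarrowtail> Bot)}"
proof
  show "cl {} \<subseteq> {x. cf (x \<rightarrowtail> Bot)}"
    using clD[of _ "{}" Hole Bot] by auto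
  show "{x. cf (x \<rightarrowtail> Bot)} \<subseteq> cl {}"
    by (auto intro!: clI cf_rule[OF Gb_rule.BotRule])
qed

section \<open>Interpretation of formulas and structures\<close>

primrec fm_sem :: "'v fm \<Rightarrow> 'v struct set" where
  "fm_sem (Var p) = {x. cf (x \<rightarrowtail> Var p)}"
| "fm_sem Bot = cl {}"
| "fm_sem (Dot a b) = cl {Comma x y | x y. x \<in> fm_sem a \<and> y \<in> fm_sem b}"
| "fm_sem (Under a b) = {z. \<forall>x\<in>fm_sem a. Comma x z \<in> fm_sem b}"
| "fm_sem (Conj a b) = fm_sem a \<inter> fm_sem b"
| "fm_sem (Disj a b) = cl (fm_sem a \<union> fm_sem b)"
| "fm_sem (Star a b) = cl {Semi x y | x y. x \<in> fm_sem a \<and> y \<in> fm_sem b}"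
| "fm_sem (Arrow a b) = {z. \<forall>x\<in>fm_sem a. Semi x z \<in> fm_sem b}"

lemma closed_fm_sem: "closed_set (fm_sem a)"
proof (induction a)
  case (Under a b)
  show ?case
    using closed_fill_preimage[OF Under.IH(2), of "(\<lambda>x. CommaR x Hole) ` fm_sem a"] by simp
next
  case (Arrow a b)
  show ?case
    using closed_fill_preimage[OF Arrow.IH(2), of "(\<lambda>x. SemiR x Hole) ` fm_sem a"] by simp
qed (simp_all add: closed_cl closed_succedent closed_Int)

lemma fm_semI:
  assumes "\<And>C c. \<forall>y\<in>fm_sem a. cf (fill C y \<rightarrowtail> c) \<Longrightarrow> cf (fill C x \<rightarrowtail> c)"
  shows "x \<in> fm_sem a"
  using clI[of "fm_sem a", OF assms] closed_fm_sem[of a] by (auto simp: closed_set_def)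

lemma cl_subset_succedent:
  assumes "\<And>y. y \<in> X \<Longrightarrow> cf (y \<rightarrowtail> c)" "x \<in> cl X"
  shows "cf (x \<rightarrowtail> c)"
  using clD[OF assms(2), of Hole c] assms(1) by simp

text \<open>Left rules give the membership, right rules the inclusion. The halves need a joint
  induction: for \<open>Under\<close> and \<open>Arrow\<close>, each half uses the opposite half for
  the antecedent.\<close>

lemma okada: "Fm a \<in> fm_sem a \<and> (\<forall>x\<in>fm_sem a. cf (x \<rightarrowtail> a))"
proof (induction a)
  case (Var p)
  show ?case by (auto intro: cf_rule[OF Gb_rule.Id])
next
  case Bot
  show ?case by (auto simp: cl_empty intro: cf_rule[OF Gb_rule.Id])
next
  case (Dot a b)
  have "Fm (Dot a b) \<in> fm_sem (Dot a b)"
    unfolding fm_sem.simps using Dot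
    by (intro clI cf_rule[OF Gb_rule.DotL]) auto
  moreover have "cf (x \<rightarrowtail> Dot a b)" if "x \<in> fm_sem (Dot a b)" for x
    using that unfolding fm_sem.simps
    by (rule cl_subset_succedent[rotated]) (use Dot in \<open>auto intro!: cf_rule[OF Gb_rule.DotR]\<close>)
  ultimately show ?case by blast
next
  case (Star a b)
  have "Fm (Star a b) \<in> fm_sem (Star a b)"
    unfolding fm_sem.simps using Star
    by (intro clI cf_rule[OF Gb_rule.StarL]) auto
  moreover have "cf (x \<rightarrowtail> Star a b)" if "x \<in> fm_sem (Star a b)" for x
    using that unfolding fm_sem.simps
    by (rule cl_subset_succedent[rotated]) (use Star in \<open>auto intro!: cf_rule[OF Gb_rule.StarR]\<close>)
  ultimately show ?case by blast
next
  case (Under a b)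
  have "Comma x (Fm (Under a b)) \<in> fm_sem b" if "x \<in> fm_sem a" for x
    using that Under by (intro fm_semI cf_rule[OF Gb_rule.UnderL]) auto
  moreover have "cf (z \<rightarrowtail> Under a b)" if "z \<in> fm_sem (Under a b)" for z
    using that Under by (intro cf_rule[OF Gb_rule.UnderR]) auto
  ultimately show ?case by simp
next
  case (Arrow a b)
  have "Semi x (Fm (Arrow a b)) \<in> fm_sem b" if "x \<in> fm_sem a" for x
    using that Arrow by (intro fm_semI cf_rule[OF Gb_rule.ArrowL]) auto
  moreover have "cf (z \<rightarrowtail> Arrow a b)" if "z \<in> fm_sem (Arrow a b)" for z
    using that Arrow by (intro cf_rule[OF Gb_rule.ArrowR]) auto
  ultimately show ?case by simp
next
  case (Conj a b)
  have "Fm (Conj a b) \<in> fm_sem a"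
    using Conj by (intro fm_semI cf_rule[OF Gb_rule.ConjL1]) auto
  moreover have "Fm (Conj a b) \<in> fm_sem b"
    using Conj by (intro fm_semI cf_rule[OF Gb_rule.ConjL2]) auto
  moreover have "cf (x \<rightarrowtail> Conj a b)" if "x \<in> fm_sem (Conj a b)" for x
    using that Conj by (intro cf_rule[OF Gb_rule.ConjR]) auto
  ultimately show ?case by simp
next
  case (Disj a b)
  have "Fm (Disj a b) \<in> fm_sem (Disj a b)"
    unfolding fm_sem.simps using Disj
    by (intro clI cf_rule[OF Gb_rule.DisjL]) auto
  moreover have "cf (x \<rightarrowtail> Disj a b)" if "x \<in> fm_sem (Disj a b)" for x
    using that unfolding fm_sem.simps
    by (rule cl_subset_succedent[rotated])
      (use Disj in \<open>auto intro: cf_rule[OF Gb_rule.DisjR1] cf_rule[OF Gb_rule.DisjR2]\<close>)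
  ultimately show ?case by blast
qed

text \<open>No closure is taken here, so rules can be applied to the elements directly; inclusion in
  a closed set is unaffected.\<close>

primrec struct_sem :: "'v struct \<Rightarrow> 'v struct set" where
  "struct_sem (Fm a) = fm_sem a"
| "struct_sem (Comma S T) = {Comma x y | x y. x \<in> struct_sem S \<and> y \<in> struct_sem T}"
| "struct_sem (Semi S T) = {Semi x y | x y. x \<in> struct_sem S \<and> y \<in> struct_sem T}"

primrec ctx_sem :: "'v ctx \<Rightarrow> 'v ctx set" where
  "ctx_sem Hole = {Hole}"
| "ctx_sem (CommaL C S) = {CommaL k y | k y. k \<in> ctx_sem C \<and> y \<in> struct_sem S}"
| "ctx_sem (CommaR S C) = {CommaR y k | k y. k \<in> ctx_sem C \<and> y \<in> struct_sem S}"
| "ctx_sem (SemiL C S) = {SemiL k y | k y. k \<in> ctx_sem C \<and> y \<in> struct_sem S}"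
| "ctx_sem (SemiR S C) = {SemiR y k | k y. k \<in> ctx_sem C \<and> y \<in> struct_sem S}"

lemma struct_sem_fill:
  "struct_sem (fill C D) = {fill k x | k x. k \<in> ctx_sem C \<and> x \<in> struct_sem D}"
proof (induction C)
  case Hole
  then show ?case by simp
next
  case (CommaL C S)
  show ?case unfolding fill.simps struct_sem.simps CommaL ctx_sem.simps by (auto; metis fill.simps)
next
  case (CommaR S C)
  show ?case unfolding fill.simps struct_sem.simps CommaR ctx_sem.simps by (auto; metis fill.simps)
next
  case (SemiL C S)
  show ?case unfolding fill.simps struct_sem.simps SemiL ctx_sem.simps by (auto; metis fill.simps)
next
  case (SemiR S C)
  show ?case unfolding fill.simps struct_sem.simps SemiR ctx_sem.simps by (auto; metis fill.simps)
qed

lemma struct_in_sem: "S \<in> struct_sem S"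
  by (induction S) (auto simp: okada)

section \<open>Soundness of all rules, and cut elimination\<close>

definition valid :: "'v sequent \<Rightarrow> bool" where
  "valid s = (case s of S \<rightarrowtail> b \<Rightarrow> struct_sem S \<subseteq> fm_sem b)"

lemma valid_Seq [simp]: "valid (S \<rightarrowtail> b) \<longleftrightarrow> struct_sem S \<subseteq> fm_sem b"
  by (simp add: valid_def)

lemma valid_fill:
  "struct_sem (fill C D) \<subseteq> fm_sem b \<longleftrightarrow>
    (\<forall>k\<in>ctx_sem C. \<forall>x\<in>struct_sem D. fill k x \<in> fm_sem b)"
  unfolding struct_sem_fill by blast

lemma valid_fill_cl:
  assumes "struct_sem D \<subseteq> cl X" "\<And>k x. k \<in> ctx_sem C \<Longrightarrow> x \<in> X \<Longrightarrow> fill k x \<in> fm_sem b"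
  shows "struct_sem (fill C D) \<subseteq> fm_sem b"
  unfolding valid_fill using assms fill_cl_closed[OF closed_fm_sem] by blast

lemma valid_fill_mono:
  assumes "struct_sem (fill C D') \<subseteq> fm_sem b" "struct_sem D \<subseteq> cl (struct_sem D')"
  shows "struct_sem (fill C D) \<subseteq> fm_sem b"
  using assms(2) by (rule valid_fill_cl) (use assms(1) valid_fill in blast)

lemma rule_sound:
  assumes "Gb_rule r ps s" "\<forall>p\<in>set ps. valid p"
  shows "valid s"
  using assms
proof (induction rule: Gb_rule.induct)
  case (DotL G a b c)
  \<comment> \<open>The product formula denotes the closure of what the comma structure
    denotes.\<close>
  then show ?case by (auto elim!: valid_fill_mono)
next
  case (StarL G a b c)
  then show ?case by (auto elim!: valid_fill_mono)
next
  case (UnderL D a G b c)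
  then have "struct_sem (fill G (Fm b)) \<subseteq> fm_sem c" by simp
  then show ?case unfolding valid_Seq
    by (rule valid_fill_mono) (use UnderL in \<open>auto intro!: subset_cl\<close>)
next
  case (ArrowL D a G b c)
  then have "struct_sem (fill G (Fm b)) \<subseteq> fm_sem c" by simp
  then show ?case unfolding valid_Seq
    by (rule valid_fill_mono) (use ArrowL in \<open>auto intro!: subset_cl\<close>)
next
  case (DisjL G a c b)
  show ?case unfolding valid_Seq
    by (rule valid_fill_cl[where X = "fm_sem a \<union> fm_sem b"]) (use DisjL in \<open>auto simp: valid_fill\<close>)
next
  case (BotRule D G a)
  show ?case unfolding valid_Seq
    by (rule valid_fill_cl[where X = "{}"]) (use BotRule in auto)
next
  case (RBot D1 D2 D3)
  \<comment> \<open>\<open>RBot\<close> acts on whole sequents with succedent \<open>Bot\<close>,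
    and \<open>cl {}\<close> consists of exactly their antecedents, so the rule applies
    elementwise.\<close>
  have "cf (Semi (Comma x z) y \<rightarrowtail> Bot)"
    if "x \<in> struct_sem D1" "y \<in> struct_sem D2" "z \<in> struct_sem D3" for x y z
  proof -
    have "Semi (Comma x y) z \<in> struct_sem (Semi (Comma D1 D2) D3)"
      using that by simp
    with RBot have "cf (Semi (Comma x y) z \<rightarrowtail> Bot)"
      by (force simp: cl_empty simp del: struct_sem.simps(2,3))
    then show ?thesis by (intro cf_rule[OF Gb_rule.RBot]) auto
  qed
  then show ?case by (auto simp: cl_empty)
next
  case (Ex G D1 D2 b)
  then have "struct_sem (fill G (Comma D1 D2)) \<subseteq> fm_sem b" by simp
  then show ?case unfolding valid_Seq
    \<comment> \<open>Since \<open>Ex\<close> works in any context, the swapped structure passes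
      every test that the original passes.\<close>
    by (rule valid_fill_mono) (auto intro!: clI cf_rule[OF Gb_rule.Ex])
next
  case (ExSemi G D1 D2 b)
  then have "struct_sem (fill G (Semi D1 D2)) \<subseteq> fm_sem b" by simp
  then show ?case unfolding valid_Seq
    by (rule valid_fill_mono) (auto intro!: clI cf_rule[OF Gb_rule.ExSemi])
next
  case (As1 G D1 D2 D3 b)
  then have "struct_sem (fill G (Comma D1 (Comma D2 D3))) \<subseteq> fm_sem b" by simp
  then show ?case unfolding valid_Seq
    by (rule valid_fill_mono) (auto intro!: clI cf_rule[OF Gb_rule.As1])
next
  case (As2 G D1 D2 D3 b)
  then have "struct_sem (fill G (Comma (Comma D1 D2) D3)) \<subseteq> fm_sem b" by simp
  then show ?case unfolding valid_Seq
    by (rule valid_fill_mono) (auto intro!: clI cf_rule[OF Gb_rule.As2])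
\<comment> \<open>Among the remaining rules, \<open>Cut\<close> reduces to transitivity of
  inclusion, applied inside a context.\<close>
qed (auto simp: valid_fill intro!: subset_cl)

lemma derivable_sound: "derivable R s \<Longrightarrow> valid s"
  by (induction rule: derivable.induct) (auto intro: rule_sound)

lemma derivable_mono: "derivable R s \<Longrightarrow> R \<subseteq> R' \<Longrightarrow> derivable R' s"
  by (induction rule: derivable.induct) (auto intro: derivable.step)

theorem theorem5:
  fixes \<Gamma> :: "'v struct" and \<beta> :: "'v fm"
  shows "Gb_derivable (\<Gamma> \<rightarrowtail> \<beta>) \<longleftrightarrow> Gb_derivable_without_cut (\<Gamma> \<rightarrowtail> \<beta>)"
proof
  assume "Gb_derivable (\<Gamma> \<rightarrowtail> \<beta>)"
  then have "valid (\<Gamma> \<rightarrowtail> \<beta>)"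
    unfolding Gb_derivable_def by (rule derivable_sound)
  then have "\<Gamma> \<in> fm_sem \<beta>"
    using struct_in_sem by auto
  then show "Gb_derivable_without_cut (\<Gamma> \<rightarrowtail> \<beta>)"
    by (simp add: Gb_derivable_without_cut_def okada)
next
  assume "Gb_derivable_without_cut (\<Gamma> \<rightarrowtail> \<beta>)"
  then show "Gb_derivable (\<Gamma> \<rightarrowtail> \<beta>)"
    unfolding Gb_derivable_def Gb_derivable_without_cut_def by (rule derivable_mono) simp
qed

end
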